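(* Let $v_\lambda$ be the only solution of the Bellman equation $v_\lambda(x)=\sup_{(c,a)\in\mathcal{C}\times\mathcal{I}}[A_c(\tau_a(x))+\lambda v_\lambda(\tau_a(x))]$. Then a measure $\mu^\lambda\in\mathcal{H}^\lambda(\nu)$ is a maximizing measure if, and only if, $$\operatorname{supp}\mu^\lambda\subseteq\left\{(x,c,a) : 0=A_c(\tau_a(x))+d_x^\lambda v_\lambda(a)\right\}.$$ In particular, the superior boundary of $\Lambda$ is essentially backwards invariant, that is, for maximizing $\mu^\lambda$, $G_c(\tau_a(x),v_\lambda(\tau_a(x)))=(x,v_\lambda(x))$ for $\mu^\lambda$-a.e. $(x,c,a)$.
   Context: $X=\mathbb{R}/\mathbb{Z}=\mathbf{S}^1$, $T:X\to X$ is the doubling map $T(x)=2x$, $0<\lambda<1$, $\mathcal{C}=\{0,\dots,m-1\}$ with $m\ge2$, $\mathcal{I}=\{0,1\}$, $\tau_i(x)=\frac12x+\frac i2$ (with $x\in[0,1)$ as representative), $i\in\mathcal{I}$, are the inverse branches of $T$, and $A_c:X\to\mathbb{R}$, $c\in\mathcal{C}$, are Lipschitz functions. $\nu\in\mathrm{Prob}(X)$ is any probability (the trace). The solution $v_\lambda$ of the Bellman equation is understood among continuous functions $X\to\mathbb{R}$. $G_c:X\times\mathbb{R}\to X\times\mathbb{R}$ is $G_c(x,y)=(T(x),A_c(x)+\lambda y)$. $\Lambda$ is the compact set, invariant for the skew IFS $(G_c)_{c\in\mathcal{C}}$ (that is, $\bigcup_{c}G_c(\Lambda)=\Lambda$),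 given by $\Lambda=\{(x,S_x(\bar c,\bar a)) : x\in X,\ \bar c\in\mathcal{C}^{\mathbb{N}},\ \bar a\in\mathcal{I}^{\mathbb{N}}\}$, where $S_x(\bar c,\bar a)=\sum_{i=0}^\infty\lambda^iA_{c_i}(\tau_{a_i}\circ\cdots\circ\tau_{a_0}(x))$. Its superior boundary is the graph $\{(x,v_\lambda(x)) : x\in X\}$, where $v_\lambda(x)=\max_{\bar c,\bar a}S_x(\bar c,\bar a)$. For $w\in C^0(X,\mathbb{R})$ put $d_x^\lambda w(a)=\lambda w(\tau_a(x))-w(x)$. The set of discounted holonomic probabilities with trace $\nu$ is $$\mathcal{H}^\lambda(\nu)=\left\{\mu\in\mathrm{Prob}(X\times\mathcal{C}\times\mathcal{I}) : \int d_x^\lambda w(a)\,d\mu(x,c,a)=-(1-\lambda)\int w\,d\nu\ \ \forall w\in C^0(X,\mathbb{R})\right\}.$$ A measure $\mu^\lambda\in\mathcal{H}^\lambda(\nu)$ is maximizing if $\int A_c(\tau_a(x))\,d\mu^\lambda(x,c,a)=\sup_{\mu\in\mathcal{H}^\lambda(\nu)}\int A_c(\tau_a(x))\,d\mu(x,c,a)$.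
   Formalization: The "only if" fails on S^1 over x=0, where the branches jump. The equivalence is proved with supp taken in the topology of representatives [0,1); for the circle topology, "if" is proved in full and "only if" only for points of the support with x≠0. *)

theory Defs
  imports "HOL-Probability.Probability"
begin

section \<open>The circle\<close>

text \<open>The circle \<open>\<real>/\<int>\<close>, with the quotient metric \<open>|x - y - n|\<close> minimised over the integers \<open>n\<close>.\<close>

quotient_type circle = real / "\<lambda>x y :: real. x - y \<in> \<int>"
proof (rule equivpI)
  show "reflp (\<lambda>x y :: real. x - y \<in> \<int>)"
    by (simp add: reflp_def)
  show "symp (\<lambda>x y :: real. x - y \<in> \<int>)"
    by (auto intro!: sympI) (metis Ints_minus minus_diff_eq)
  show "transp (\<lambda>x y :: real. x - y \<in> \<int>)"
    by (auto intro!: transpI) (metis Ints_add diff_add_cancel add_diff_eq)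
qed

lemma infdist_Ints_shift_le:
  assumes "n \<in> \<int>"
  shows "infdist (x + n) \<int> \<le> infdist (x :: real) \<int>"
proof -
  obtain k where k: "k \<in> \<int>" "infdist x \<int> = dist x k"
    using infdist_attains_inf[of "\<int>" x] closed_Ints Ints_0 by (metis empty_iff)
  have "infdist (x + n) \<int> \<le> dist (x + n) (k + n)"
    by (rule infdist_le) (use assms k in auto)
  then show ?thesis using k by (simp add: dist_real_def)
qed

lemma infdist_Ints_cong:
  assumes "x - y \<in> \<int>"
  shows "infdist (x :: real) \<int> = infdist y \<int>"
proof (rule antisym)
  show "infdist x \<int> \<le> infdist y \<int>"
    using infdist_Ints_shift_le[OF assms, of y] by simp
  have "y - x \<in> \<int>" using Ints_minus[OF assms] by simp
  then show "infdist y \<int> \<le> infdist x \<int>"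
    using infdist_Ints_shift_le[of "y - x" x] by simp
qed

instantiation circle :: metric_space
begin

lift_definition dist_circle :: "circle \<Rightarrow> circle \<Rightarrow> real"
  is "\<lambda>x y. infdist (x - y) \<int>"
proof -
  fix x x' y y' :: real
  assume "x - x' \<in> \<int>" "y - y' \<in> \<int>"
  then have "(x - x') - (y - y') \<in> \<int>" by (rule Ints_diff)
  then show "infdist (x - y) \<int> = infdist (x' - y') \<int>"
    by (intro infdist_Ints_cong) (simp add: algebra_simps)
qed

definition uniformity_circle :: "(circle \<times> circle) filter"
  where "uniformity_circle = (INF e\<in>{0<..}. principal {(x, y). dist x y < e})"

definition open_circle :: "circle set \<Rightarrow> bool"
  where "open_circle U = (\<forall>x\<in>U. \<forall>\<^sub>F (x', y) in uniformity. x' = x \<longrightarrow> y \<in> U)"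

instance
proof
  fix x y z :: circle
  show "dist x y = 0 \<longleftrightarrow> x = y"
  proof transfer
    fix x y :: real
    have "(\<int> :: real set) \<noteq> {}" using Ints_0 by blast
    then show "infdist (x - y) \<int> = 0 \<longleftrightarrow> x - y \<in> \<int>"
      using in_closed_iff_infdist_zero[OF closed_Ints] by blast
  qed
  show "dist x y \<le> dist x z + dist y z"
  proof transfer
    fix x y z :: real
    obtain k where k: "k \<in> \<int>" "infdist (x - z) \<int> = dist (x - z) k"
      using infdist_attains_inf[of "\<int>" "x - z"] closed_Ints Ints_0 by (metis empty_iff)
    obtain l where l: "l \<in> \<int>" "infdist (y - z) \<int> = dist (y - z) l"
      using infdist_attains_inf[of "\<int>" "y - z"] closed_Ints Ints_0 by (metis empty_iff)
    have "infdist (x - y) \<int> \<le> dist (x - y) (k - l)"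
      by (rule infdist_le) (use k l in auto)
    also have "\<dots> \<le> dist (x - z) k + dist (y - z) l"
      by (simp add: dist_real_def)
    finally show "infdist (x - y) \<int> \<le> infdist (x - z) \<int> + infdist (y - z) \<int>"
      using k l by simp
  qed
qed (simp_all add: uniformity_circle_def open_circle_def)

end

lift_definition proj :: "real \<Rightarrow> circle" is "\<lambda>x. x" .

text \<open>The representative in \<open>[0,1)\<close>.\<close>

lift_definition rep :: "circle \<Rightarrow> real" is frac
proof -
  fix x y :: real
  assume "x - y \<in> \<int>"
  then obtain k where "x = y + of_int k" by (metis Ints_cases add.commute diff_add_cancel)
  then show "frac x = frac y" by (simp add: frac_def)
qed

lemma proj_rep: "proj (rep x) = x"
  by transfer (simp add: frac_def)

lemma rep_proj: "rep (proj x) = frac x"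
  by transfer simp

lemma dist_proj: "dist (proj x) (proj y) = infdist (x - y) \<int>"
  by transfer simp

text \<open>The metric induces the quotient topology.\<close>

lemma open_iff_open_vimage_proj: "open U \<longleftrightarrow> open (proj -` U)"
proof
  assume U: "open U"
  show "open (proj -` U)"
    unfolding open_dist
  proof
    fix x assume "x \<in> proj -` U"
    then obtain e where e: "e > 0" "\<And>y. dist y (proj x) < e \<Longrightarrow> y \<in> U"
      using U unfolding open_dist by auto
    have "dist (proj y) (proj x) \<le> dist y x" for y
      using infdist_le[of 0 "\<int>" "y - x"] by (simp add: dist_proj dist_real_def)
    then show "\<exists>e>0. \<forall>y. dist y x < e \<longrightarrow> y \<in> proj -` U"
      using e by (metis order.strict_trans1 vimage_eq)
  qed
next
  assume V: "open (proj -` U)"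
  show "open U"
    unfolding open_dist
  proof
    fix p assume p: "p \<in> U"
    obtain x where x: "p = proj x" by (metis proj_rep)
    obtain e where e: "e > 0" "\<And>y. dist y x < e \<Longrightarrow> y \<in> proj -` U"
      using V p x unfolding open_dist by auto
    have "q \<in> U" if q: "dist q p < e" for q
    proof -
      obtain y where y: "q = proj y" by (metis proj_rep)
      obtain k where k: "k \<in> \<int>" "infdist (y - x) \<int> = dist (y - x) k"
        using infdist_attains_inf[of "\<int>" "y - x"] closed_Ints Ints_0 by (metis empty_iff)
      have "dist (y - k) x < e"
        using q k by (simp add: x y dist_proj dist_real_def algebra_simps)
      moreover have "proj (y - k) = proj y"
        using k by transfer simp
      ultimately show ?thesis using e(2)[of "y - k"] y by simp
    qed
    then show "\<exists>e>0. \<forall>y. dist y p < e \<longrightarrow> y \<in> U" using e(1) by blast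
  qed
qed

lift_definition doubling :: "circle \<Rightarrow> circle" is "\<lambda>x. 2 * x"
  by (metis Ints_mult Ints_numeral right_diff_distrib)

definition tau :: "nat \<Rightarrow> circle \<Rightarrow> circle"
  where "tau i x = proj (rep x / 2 + real i / 2)"

lemma doubling_tau: "doubling (tau i x) = x"
proof -
  have "doubling (proj (rep x / 2 + real i / 2)) = proj (rep x)"
    by transfer (simp add: algebra_simps)
  then show ?thesis by (simp add: tau_def proj_rep)
qed


section \<open>The skew IFS and its invariant set\<close>

text \<open>The colours are \<open>{..<m}\<close>, the indices of the inverse branches \<open>{0, 1}\<close>;
  \<open>A c\<close> is only relevant for \<open>c < m\<close>.\<close>

definition G :: "(nat \<Rightarrow> circle \<Rightarrow> real) \<Rightarrow> real \<Rightarrow> nat \<Rightarrow> circle \<times> real \<Rightarrow> circle \<times> real"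
  where "G A lam c = (\<lambda>(x, y). (doubling x, A c x + lam * y))"

primrec tau_iter :: "(nat \<Rightarrow> nat) \<Rightarrow> nat \<Rightarrow> circle \<Rightarrow> circle" where
  "tau_iter a 0 x = tau (a 0) x"
| "tau_iter a (Suc i) x = tau (a (Suc i)) (tau_iter a i x)"

definition S :: "(nat \<Rightarrow> circle \<Rightarrow> real) \<Rightarrow> real \<Rightarrow> circle \<Rightarrow> (nat \<Rightarrow> nat) \<Rightarrow> (nat \<Rightarrow> nat) \<Rightarrow> real"
  where "S A lam x c a = (\<Sum>i. lam ^ i * A (c i) (tau_iter a i x))"

definition Lam :: "nat \<Rightarrow> (nat \<Rightarrow> circle \<Rightarrow> real) \<Rightarrow> real \<Rightarrow> (circle \<times> real) set"
  where "Lam m A lam = {(x, S A lam x c a) |x c a. range c \<subseteq> {..<m} \<and> range a \<subseteq> {0, 1}}"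

definition superior_boundary :: "('a \<times> real) set \<Rightarrow> ('a \<times> real) set"
  where "superior_boundary L = {(x, y). (x, y) \<in> L \<and> (\<forall>y'. (x, y') \<in> L \<longrightarrow> y' \<le> y)}"


section \<open>The Bellman equation\<close>

definition bellman_solution ::
    "nat \<Rightarrow> (nat \<Rightarrow> circle \<Rightarrow> real) \<Rightarrow> real \<Rightarrow> (circle \<Rightarrow> real) \<Rightarrow> bool"
  where "bellman_solution m A lam v \<longleftrightarrow> continuous_on UNIV v \<and>
    (\<forall>x. v x = (SUP (c, a) \<in> {..<m} \<times> {0, 1}. A c (tau a x) + lam * v (tau a x)))"

definition v_lam :: "nat \<Rightarrow> (nat \<Rightarrow> circle \<Rightarrow> real) \<Rightarrow> real \<Rightarrow> circle \<Rightarrow> real"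
  where "v_lam m A lam = (THE v. bellman_solution m A lam v)"


section \<open>Discounted holonomic probabilities\<close>

definition XCI :: "nat \<Rightarrow> (circle \<times> nat \<times> nat) measure"
  where "XCI m = borel \<Otimes>\<^sub>M count_space {..<m} \<Otimes>\<^sub>M count_space {0, 1}"

definition disc_diff :: "real \<Rightarrow> (circle \<Rightarrow> real) \<Rightarrow> circle \<Rightarrow> nat \<Rightarrow> real"
  where "disc_diff lam w x a = lam * w (tau a x) - w x"

definition holonomic :: "nat \<Rightarrow> real \<Rightarrow> circle measure \<Rightarrow> (circle \<times> nat \<times> nat) measure set"
  where "holonomic m lam \<nu> = {\<mu> \<in> space (prob_algebra (XCI m)). \<forall>w. continuous_on UNIV w \<longrightarrow>
    integral\<^sup>L \<mu> (\<lambda>(x, c, a). disc_diff lam w x a) = - (1 - lam) * integral\<^sup>L \<nu> w}"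

definition maximizing ::
    "nat \<Rightarrow> (nat \<Rightarrow> circle \<Rightarrow> real) \<Rightarrow> real \<Rightarrow> circle measure \<Rightarrow> (circle \<times> nat \<times> nat) measure \<Rightarrow> bool"
  where "maximizing m A lam \<nu> \<mu> \<longleftrightarrow> \<mu> \<in> holonomic m lam \<nu> \<and>
    integral\<^sup>L \<mu> (\<lambda>(x, c, a). A c (tau a x)) =
      (SUP \<mu>' \<in> holonomic m lam \<nu>. integral\<^sup>L \<mu>' (\<lambda>(x, c, a). A c (tau a x)))"


section \<open>Supports\<close>

text \<open>The support of a Borel measure with respect to a topology.\<close>

definition supp :: "'a topology \<Rightarrow> 'a measure \<Rightarrow> 'a set"
  where "supp T M = {p \<in> topspace T. \<forall>U. openin T U \<and> p \<in> U \<longrightarrow> 0 < emeasure M U}"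

text \<open>The inverse branches \<open>tau i\<close> are given by continuous formulas in the representative
  \<open>rep x \<in> [0,1)\<close>, but on the circle they jump at the point \<open>0\<close>.  So the set where
  \<open>A c (tau a x) + disc_diff lam v x a = 0\<close> need not be closed for the circle topology, and the
  support of a measure carried by it may contain further points over \<open>0\<close>.  It is closed for the
  topology of \<open>[0,1)\<close>, which differs from that of the circle only at \<open>0\<close> and has the same Borel
  sets.  Both topologies on the product \<open>X \<times> C \<times> I\<close> are needed.\<close>

definition circle_top :: "nat \<Rightarrow> (circle \<times> nat \<times> nat) topology"
  where "circle_top m = prod_topology euclidean
    (prod_topology (discrete_topology {..<m}) (discrete_topology {0, 1}))"

definition rep_top :: "nat \<Rightarrow> (circle \<times> nat \<times> nat) topology"
  where "rep_top m = prod_topology (pullback_topology UNIV rep euclidean)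
    (prod_topology (discrete_topology {..<m}) (discrete_topology {0, 1}))"

definition zero_set ::
    "nat \<Rightarrow> (nat \<Rightarrow> circle \<Rightarrow> real) \<Rightarrow> real \<Rightarrow> (circle \<Rightarrow> real) \<Rightarrow> (circle \<times> nat \<times> nat) set"
  where "zero_set m A lam v =
    {(x, c, a). c \<in> {..<m} \<and> a \<in> {0, 1} \<and> 0 = A c (tau a x) + disc_diff lam v x a}"

end

theory Submission
  imports Defs
begin

text \<open>
  Write \<open>V\<close> for the solution of the Bellman equation and call
  \<open>A c (tau a x) + lam * V (tau a x) - V x\<close> the slack of the choice \<open>(c, a)\<close> at \<open>x\<close>.  By the
  Bellman equation the slack is never positive, and at every point some choice has slack \<open>0\<close>; the
  set \<open>zero_set m A lam V\<close> is the set of choices without slack.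

  The solution exists and is unique because the Bellman operator is a contraction of the continuous
  functions on the circle.  That it maps continuous functions to continuous functions is not obvious,
  since the inverse branches jump at \<open>0\<close>; it holds because the pair of the two preimages varies
  continuously (\<open>tau_proj_set\<close>).

  Testing the holonomy condition against \<open>V\<close> shows that the payoff of a holonomic probability with
  trace \<open>\<nu>\<close> is \<open>(1 - lam) * integral\<^sup>L \<nu> V\<close> plus the integral of the slack (\<open>integral_payoff\<close>).
  The first term does not depend on the probability and the second is at most \<open>0\<close>.  The bound is
  attained: follow a measurable choice without slack backwards, starting from \<open>\<nu>\<close>, and stop at an
  independent geometric time with success probability \<open>1 - lam\<close>; the memorylessness of that time
  is the holonomy condition (\<open>strategy_measure_holonomic\<close>).  Hence a holonomic probability is
  maximizing if and only if its slack vanishes almost everywhere (\<open>maximizing_iff_AE\<close>).  Since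
  \<open>tau a\<close> is a right inverse of \<open>doubling\<close>, vanishing slack is literally the backward invariance
  of the graph of \<open>V\<close>.

  It remains to pass between null sets and supports.  In the topology of the representatives the
  zero set is closed and there is a countable base of Borel sets, so a probability on
  \<open>X \<times> C \<times> I\<close> is carried by the zero set if and only if its support is contained in it.
  The topology of the circle is coarser, so its supports are larger, but only over the point \<open>0\<close>.

  The statement on the superior boundary is the same computation along one backward orbit: the
  discounted slacks along an itinerary sum up to \<open>S A lam x c a - V x\<close>, because the terms in \<open>V\<close>
  telescope (\<open>sums_S_minus_V\<close>).
\<close>


section \<open>The circle and its inverse branches\<close>

lemma continuous_on_proj: "continuous_on UNIV proj"
  by (auto simp: continuous_on_open_vimage open_iff_open_vimage_proj)

lemma continuous_on_circleI:
  fixes f :: "circle \<Rightarrow> 'a::topological_space"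
  assumes "continuous_on UNIV (\<lambda>t. f (proj t))"
  shows "continuous_on UNIV f"
  using assms by (auto simp: continuous_on_open_vimage open_iff_open_vimage_proj vimage_def)

lemma rep_bounds: "0 \<le> rep x" "rep x < 1"
  by (transfer, simp add: frac_lt_1)+

lemma rep_eq_0_iff: "rep x = 0 \<longleftrightarrow> x = proj 0"
  by (metis proj_rep rep_proj frac_of_int of_int_0)

lemma compact_UNIV_circle: "compact (UNIV :: circle set)"
proof -
  have "x \<in> proj ` {0..1}" for x
    using rep_bounds[of x] by (intro image_eqI[of _ _ "rep x"]) (auto simp: proj_rep)
  then have "proj ` {0..1} = UNIV" by auto
  then show ?thesis
    using compact_continuous_image[OF continuous_on_subset[OF continuous_on_proj], of "{0..1}"] by simp
qed

lemma bounded_range_circle: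
  fixes f :: "circle \<Rightarrow> 'a::metric_space"
  assumes "continuous_on UNIV f"
  shows "bounded (range f)"
  by (rule compact_imp_bounded[OF compact_continuous_image[OF assms compact_UNIV_circle]])

lemma bounded_circle_functionE:
  fixes f :: "circle \<Rightarrow> real"
  assumes "continuous_on UNIV f"
  obtains B where "\<And>x. \<bar>f x\<bar> \<le> B"
proof -
  obtain B where "0 < B" "\<And>x. norm (f x) \<le> B"
    using bounded_range_circle[OF assms] unfolding bounded_pos by blast
  then show thesis by (intro that[of B]) auto
qed

text \<open>Away from the point \<open>0\<close> the representative is a chart of the circle: the preimage of
  \<open>V\<close> in the line is the union of the integer translates of \<open>V\<close>.\<close>

lemma open_vimage_rep:
  assumes "open V" "V \<subseteq> {0<..<1}"
  shows "open (rep -` V)"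
proof -
  have "frac t \<in> V \<longleftrightarrow> (\<exists>n. t \<in> (+) (of_int n) ` V)" for t
  proof
    assume "frac t \<in> V"
    then show "\<exists>n. t \<in> (+) (of_int n) ` V"
      by (intro exI[of _ "\<lfloor>t\<rfloor>"] image_eqI[of _ _ "frac t"]) (auto simp: frac_def)
  next
    assume "\<exists>n. t \<in> (+) (of_int n) ` V"
    then obtain n s where s: "t = of_int n + s" "s \<in> V" by auto
    then have "0 \<le> s" "s < 1" using assms(2) by force+
    then have "frac t = s" using s(1) by (simp add: frac_unique_iff)
    then show "frac t \<in> V" using s by simp
  qed
  then have "proj -` rep -` V = (\<Union>n. (+) (of_int n) ` V)"
    unfolding set_eq_iff by (simp add: rep_proj)
  then show ?thesis
    using assms(1) by (auto simp: open_iff_open_vimage_proj intro!: open_translation)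
qed

text \<open>An open set of representatives differs from a circle-open set by at most the point \<open>0\<close>,
  which is closed.\<close>

lemma borel_measurable_rep: "rep \<in> borel_measurable borel"
proof (rule borel_measurableI)
  fix V :: "real set" assume V: "open V"
  have "x \<in> rep -` V \<longleftrightarrow> x \<in> rep -` (V \<inter> {0<..<1}) \<union> (if 0 \<in> V then {proj 0} else {})" for x
    using rep_bounds[of x] rep_eq_0_iff[of x] by (cases "x = proj 0") auto
  then have "rep -` V = rep -` (V \<inter> {0<..<1}) \<union> (if 0 \<in> V then {proj 0} else {})"
    by blast
  moreover have "rep -` (V \<inter> {0<..<1}) \<in> sets borel"
    using V by (intro borel_open open_vimage_rep) auto
  ultimately have "rep -` V \<in> sets borel" by (simp del: vimage_Int)
  then show "rep -` V \<inter> space borel \<in> sets borel" by simp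
qed

lemma borel_measurable_tau: "tau a \<in> borel \<rightarrow>\<^sub>M borel"
proof -
  note [measurable] = borel_measurable_rep borel_measurable_continuous_onI[OF continuous_on_proj]
  show ?thesis unfolding tau_def by measurable
qed

text \<open>Each inverse branch jumps at \<open>0\<close>, but the unordered pair of preimages does not: going once
  around the circle exchanges the two branches.  This is why the Bellman operator preserves
  continuity, and for the proof it is the parity of \<open>\<lfloor>t\<rfloor>\<close> that matters.\<close>

lemma tau_proj_set:
  "{tau 0 (proj t), tau 1 (proj t)} = {proj (t / 2), proj (t / 2 + 1 / 2)}"
proof -
  define n where "n = \<lfloor>t\<rfloor>"
  have f: "frac t = t - of_int n" by (simp add: frac_def n_def)
  have eq: "proj s = proj s'" if "s - s' = of_int k" for s s' k
    using that by transfer simp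
  consider k where "n = 2 * k" | k where "n = 2 * k + 1" by (metis evenE oddE)
  then show ?thesis
  proof cases
    case 1
    then have "tau 0 (proj t) = proj (t / 2)" "tau 1 (proj t) = proj (t / 2 + 1 / 2)"
      unfolding tau_def rep_proj f by (auto intro!: eq[where k="-k"] simp: field_simps)
    then show ?thesis by simp
  next
    case 2
    then have "tau 0 (proj t) = proj (t / 2 + 1 / 2)"
      unfolding tau_def rep_proj f by (intro eq[where k="-k-1"]) (simp add: field_simps)
    moreover from 2 have "tau 1 (proj t) = proj (t / 2)"
      unfolding tau_def rep_proj f by (intro eq[where k="-k"]) (simp add: field_simps)
    ultimately show ?thesis by auto
  qed
qed


section \<open>Supports in the two topologies\<close>

lemma topspace_rep_top: "topspace (rep_top m) = UNIV \<times> {..<m} \<times> {0, 1}"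
  by (simp add: rep_top_def topspace_pullback_topology)

text \<open>Since the colours and branches are discrete, an open set is just a choice of an open set of
  representatives in each slice.\<close>

lemma openin_rep_top_iff:
  "openin (rep_top m) U \<longleftrightarrow> U \<subseteq> UNIV \<times> {..<m} \<times> {0, 1} \<and>
    (\<forall>c a. \<exists>V. open V \<and> {x. (x, c, a) \<in> U} = rep -` V)"
  (is "?L \<longleftrightarrow> ?R")
proof
  assume L: ?L
  have sub: "U \<subseteq> UNIV \<times> {..<m} \<times> {0, 1}"
    using openin_subset[OF L] by (simp add: topspace_rep_top)
  have "\<exists>V. open V \<and> {x. (x, c, a) \<in> U} = rep -` V" for c a
  proof (intro exI conjI)
    define V where "V = \<Union>{V. open V \<and> rep -` V \<subseteq> {x. (x, c, a) \<in> U}}"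
    show "open V" unfolding V_def by auto
    show "{x. (x, c, a) \<in> U} = rep -` V"
    proof
      show "rep -` V \<subseteq> {x. (x, c, a) \<in> U}" unfolding V_def by auto
      show "{x. (x, c, a) \<in> U} \<subseteq> rep -` V"
      proof
        fix x assume "x \<in> {x. (x, c, a) \<in> U}"
        then have "(x, c, a) \<in> U" by simp
        then obtain W Y where W: "openin (pullback_topology UNIV rep euclidean) W"
          "x \<in> W" "(c, a) \<in> Y" "W \<times> Y \<subseteq> U"
          using L[unfolded rep_top_def openin_prod_topology_alt[of "pullback_topology UNIV rep euclidean"],
            rule_format, of x "(c, a)"] by auto
        then obtain V' where "open V'" "W = rep -` V'"
          by (auto simp: openin_pullback_topology)
        then show "x \<in> rep -` V" using W unfolding V_def by blast
      qed
    qed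
  qed
  then show ?R using sub by blast
next
  assume R: ?R
  show ?L unfolding rep_top_def openin_prod_topology_alt[of "pullback_topology UNIV rep euclidean"]
  proof (intro allI impI)
    fix x and p assume "(x, p) \<in> U"
    moreover obtain c a where p: "p = (c, a)" by force
    ultimately have xU: "(x, c, a) \<in> U" by simp
    obtain V where V: "open V" "{x. (x, c, a) \<in> U} = rep -` V" using R by blast
    have "openin (prod_topology (discrete_topology {..<m}) (discrete_topology {0, 1})) ({c} \<times> {a})"
      using xU R unfolding openin_prod_Times_iff by auto
    moreover have "openin (pullback_topology UNIV rep euclidean) (rep -` V)"
      using V by (auto simp: openin_pullback_topology)
    ultimately show "\<exists>W Y. openin (pullback_topology UNIV rep euclidean) W \<and>
        openin (prod_topology (discrete_topology {..<m}) (discrete_topology {0, 1})) Y \<and>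
        x \<in> W \<and> p \<in> Y \<and> W \<times> Y \<subseteq> U"
      using V xU p by (intro exI[of _ "rep -` V"] exI[of _ "{c} \<times> {a}"]) auto
  qed
qed

lemma topspace_circle_top: "topspace (circle_top m) = UNIV \<times> {..<m} \<times> {0, 1}"
  by (simp add: circle_top_def)

lemma space_XCI: "space (XCI m) = UNIV \<times> {..<m} \<times> {0, 1}"
  by (simp add: XCI_def space_pair_measure)

lemma openin_rep_top_measurable:
  assumes "openin (rep_top m) U"
  shows "U \<in> sets (XCI m)"
proof -
  have sub: "U \<subseteq> UNIV \<times> {..<m} \<times> {0, 1}"
    and sl: "\<And>c a. \<exists>V. open V \<and> {x. (x, c, a) \<in> U} = rep -` V"
    using assms unfolding openin_rep_top_iff by blast+
  have "{x. (x, c, a) \<in> U} \<in> sets borel" for c a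
    using sl[of c a] measurable_sets[OF borel_measurable_rep] by force
  then have "(\<Union>c\<in>{..<m}. \<Union>a\<in>{0, 1}. {x. (x, c, a) \<in> U} \<times> {c} \<times> {a}) \<in> sets (XCI m)"
    unfolding XCI_def by (intro sets.finite_UN pair_measureI) auto
  also have "(\<Union>c\<in>{..<m}. \<Union>a\<in>{0, 1}. {x. (x, c, a) \<in> U} \<times> {c} \<times> {a}) = U"
    using sub by auto
  finally show ?thesis .
qed

lemma second_countable_rep_top: "second_countable (rep_top m)"
proof -
  obtain \<B> :: "real set set" where \<B>: "countable \<B>" "\<And>V. V \<in> \<B> \<Longrightarrow> open V"
    "\<And>S. open S \<Longrightarrow> \<exists>U. U \<subseteq> \<B> \<and> S = \<Union>U"
    by (rule univ_second_countable) blast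
  define \<C> where "\<C> = (\<lambda>(V, c, a). rep -` V \<times> {c} \<times> {a}) ` (\<B> \<times> {..<m} \<times> {0::nat, 1})"
  have "countable \<C>" unfolding \<C>_def using \<B>(1) by auto
  moreover have "openin (rep_top m) V" if V: "V \<in> \<C>" for V
  proof -
    obtain W c a where W: "V = rep -` W \<times> {c} \<times> {a}" "W \<in> \<B>" "c < m" "a \<in> {0, 1}"
      using V unfolding \<C>_def by auto
    have "\<exists>W'. open W' \<and> {x. (x, c', a') \<in> V} = rep -` W'" for c' a'
    proof (intro exI conjI)
      show "open (if c' = c \<and> a' = a then W else {})" using W \<B>(2) by auto
      show "{x. (x, c', a') \<in> V} = rep -` (if c' = c \<and> a' = a then W else {})"
        using W by auto
    qed
    then show ?thesis using W unfolding openin_rep_top_iff by auto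
  qed
  moreover have "\<exists>V\<in>\<C>. p \<in> V \<and> V \<subseteq> U" if U: "openin (rep_top m) U" "p \<in> U" for U p
  proof -
    obtain x c a where p: "p = (x, c, a)" by (cases p)
    obtain V where V: "open V" "{x. (x, c, a) \<in> U} = rep -` V"
      using U unfolding openin_rep_top_iff by blast
    have "rep x \<in> V" using V U p by blast
    then obtain W where W: "W \<in> \<B>" "rep x \<in> W" "W \<subseteq> V"
      using \<B>(3)[OF V(1)] by blast
    have ca: "c < m" "a \<in> {0, 1}" using U p unfolding openin_rep_top_iff by auto
    have "(W, c, a) \<in> \<B> \<times> {..<m} \<times> {0, 1}" using W ca by auto
    then have "rep -` W \<times> {c} \<times> {a} \<in> \<C>" unfolding \<C>_def by (auto simp: image_iff)
    moreover have "rep -` W \<times> {c} \<times> {a} \<subseteq> U" using V W by auto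
    ultimately show ?thesis
      using W p by (intro bexI[of _ "rep -` W \<times> {c} \<times> {a}"]) auto
  qed
  ultimately show ?thesis
    unfolding second_countable_def by (intro exI[of _ \<C>] conjI ballI allI impI) auto
qed

text \<open>The complement of the support is a union of null open sets.  A countable base reduces it to a
  countable union, and this is what turns an inclusion of supports into a statement about null
  sets.\<close>

lemma emeasure_compl_supp:
  assumes "second_countable T" "\<And>U. openin T U \<Longrightarrow> U \<in> sets M"
  shows "emeasure M (topspace T - supp T M) = 0" "topspace T - supp T M \<in> sets M"
proof -
  obtain \<B> where \<B>: "countable \<B>" "\<And>V. V \<in> \<B> \<Longrightarrow> openin T V"
    "\<And>U x. openin T U \<Longrightarrow> x \<in> U \<Longrightarrow> \<exists>V\<in>\<B>. x \<in> V \<and> V \<subseteq> U"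
    using assms(1) unfolding second_countable_def by metis
  define \<N> where "\<N> = {V \<in> \<B>. V \<in> null_sets M}"
  have "topspace T - supp T M \<subseteq> \<Union>\<N>"
  proof
    fix p assume "p \<in> topspace T - supp T M"
    then obtain U where U: "openin T U" "p \<in> U" "emeasure M U = 0"
      unfolding supp_def by auto
    obtain V where V: "V \<in> \<B>" "p \<in> V" "V \<subseteq> U" using \<B>(3) U by blast
    have "U \<in> null_sets M" using U assms(2) by auto
    then have "V \<in> null_sets M"
      using V \<B>(2) assms(2) null_sets_subset by blast
    then show "p \<in> \<Union>\<N>" using V by (auto simp: \<N>_def)
  qed
  moreover have "\<Union>\<N> \<subseteq> topspace T - supp T M"
  proof
    fix p assume "p \<in> \<Union>\<N>"
    then obtain V where V: "V \<in> \<B>" "V \<in> null_sets M" "p \<in> V" by (auto simp: \<N>_def)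
    then have "p \<in> topspace T" using \<B>(2) openin_subset by blast
    moreover have "p \<notin> supp T M"
      using V \<B>(2)[OF V(1)] unfolding supp_def by (auto dest!: null_setsD1)
    ultimately show "p \<in> topspace T - supp T M" by blast
  qed
  ultimately have eq: "topspace T - supp T M = \<Union>\<N>" by (rule antisym)
  have "(\<Union>V\<in>\<N>. V) \<in> null_sets M"
    using \<B>(1) by (intro null_sets_UN') (auto simp: \<N>_def)
  then have "\<Union>\<N> \<in> null_sets M" by simp
  then show "emeasure M (topspace T - supp T M) = 0" "topspace T - supp T M \<in> sets M"
    unfolding eq by auto
qed

text \<open>Every circle-open set \<open>W\<close> is the set of points with representative in the open set
  \<open>proj -` W\<close>.\<close>

lemma openin_circle_top_imp_rep_top:
  assumes "openin (circle_top m) U"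
  shows "openin (rep_top m) U"
proof -
  have "openin (pullback_topology UNIV rep euclidean) W" if "open W" for W
  proof -
    have "W = rep -` (proj -` W)" by (auto simp: proj_rep)
    then show ?thesis
      using that by (auto simp: openin_pullback_topology open_iff_open_vimage_proj)
  qed
  then have W: "openin (pullback_topology UNIV rep euclidean) W" if "openin euclidean W" for W
    using that by simp
  show ?thesis
    unfolding rep_top_def openin_prod_topology_alt[of "pullback_topology UNIV rep euclidean"]
  proof (intro allI impI)
    fix x p assume "(x, p) \<in> U"
    then obtain X Y where "openin euclidean X" "x \<in> X" "p \<in> Y" "X \<times> Y \<subseteq> U"
      "openin (prod_topology (discrete_topology {..<m}) (discrete_topology {0, 1})) Y"
      using assms[unfolded circle_top_def openin_prod_topology_alt[of euclidean], rule_format, of x p]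
      by auto
    with W[of X] show "\<exists>X Y. openin (pullback_topology UNIV rep euclidean) X \<and>
        openin (prod_topology (discrete_topology {..<m}) (discrete_topology {0, 1})) Y \<and>
        x \<in> X \<and> p \<in> Y \<and> X \<times> Y \<subseteq> U"
      by (intro exI[of _ X] exI[of _ Y] conjI)
  qed
qed

text \<open>The finer the topology, the smaller the support.\<close>

lemma supp_rep_top_subset: "supp (rep_top m) \<mu> \<subseteq> supp (circle_top m) \<mu>"
  using openin_circle_top_imp_rep_top
  by (auto simp: supp_def topspace_rep_top topspace_circle_top)

text \<open>Over points other than \<open>0\<close> the two topologies have the same small neighbourhoods, because
  the interval of representatives can be shrunk into \<open>(0,1)\<close>.\<close>

lemma supp_circle_top_subset:
  assumes "sets \<mu> = sets (XCI m)"
  shows "supp (circle_top m) \<mu> - {proj 0} \<times> UNIV \<subseteq> supp (rep_top m) \<mu>"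
proof
  fix p assume p: "p \<in> supp (circle_top m) \<mu> - {proj 0} \<times> UNIV"
  obtain x c a where pe: "p = (x, c, a)" by (cases p)
  have x: "0 < rep x" "rep x < 1" using p rep_bounds[of x] rep_eq_0_iff[of x]
    by (auto simp: pe less_le)
  have ca: "c < m" "a \<in> {0, 1}" using p by (auto simp: supp_def topspace_circle_top pe)
  have "0 < emeasure \<mu> U" if U: "openin (rep_top m) U" "p \<in> U" for U
  proof -
    obtain V where V: "open V" "{x. (x, c, a) \<in> U} = rep -` V"
      using U unfolding openin_rep_top_iff by blast
    define W where "W = rep -` (V \<inter> {0<..<1}) \<times> ({c} \<times> {a})"
    have "open (rep -` (V \<inter> {0<..<1}))" using V by (intro open_vimage_rep) auto
    then have "openin (circle_top m) W"
      unfolding W_def circle_top_def openin_prod_Times_iff using ca by auto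
    moreover have "p \<in> W" using x V U by (auto simp: W_def pe)
    ultimately have "0 < emeasure \<mu> W" using p by (auto simp: supp_def)
    also have "emeasure \<mu> W \<le> emeasure \<mu> U"
      using V openin_rep_top_measurable[OF U(1)] assms
      by (intro emeasure_mono) (auto simp: W_def)
    finally show ?thesis .
  qed
  then show "p \<in> supp (rep_top m) \<mu>"
    using ca by (auto simp: supp_def topspace_rep_top pe)
qed


section \<open>The Bellman equation\<close>

lemma continuous_on_SUP_finite:
  fixes f :: "'i \<Rightarrow> 'a::topological_space \<Rightarrow> real"
  assumes "finite I" "I \<noteq> {}" "\<And>i. i \<in> I \<Longrightarrow> continuous_on D (f i)"
  shows "continuous_on D (\<lambda>x. SUP i\<in>I. f i x)"
proof -
  have "continuous_on D (\<lambda>x. Max ((\<lambda>i. f i x) ` I))"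
    using assms by (induction I rule: finite_ne_induct) (auto intro!: continuous_on_max)
  then show ?thesis using assms by (simp add: cSup_eq_Max)
qed

locale discounted_skew_ifs =
  fixes lam :: real and m :: nat and A :: "nat \<Rightarrow> circle \<Rightarrow> real"
  assumes lam: "0 < lam" "lam < 1" and m_pos: "0 < m"
    and continuous_A: "\<And>c. c < m \<Longrightarrow> continuous_on UNIV (A c)"
begin

definition bellman_op :: "(circle \<Rightarrow> real) \<Rightarrow> circle \<Rightarrow> real" where
  "bellman_op v x = (SUP (c, a) \<in> {..<m} \<times> {0, 1}. A c (tau a x) + lam * v (tau a x))"

lemma bellman_solution_iff:
  "bellman_solution m A lam v \<longleftrightarrow> continuous_on UNIV v \<and> (\<forall>x. v x = bellman_op v x)"
  unfolding bellman_solution_def bellman_op_def ..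

lemma bellman_op_ge:
  assumes "c < m" "a \<in> {0, 1}"
  shows "A c (tau a x) + lam * v (tau a x) \<le> bellman_op v x"
proof -
  let ?f = "\<lambda>(c, a). A c (tau a x) + lam * v (tau a x)"
  have "bdd_above (?f ` ({..<m} \<times> {0, 1}))" by (rule bdd_above_finite) simp
  then have "?f (c, a) \<le> (SUP p \<in> {..<m} \<times> {0, 1}. ?f p)"
    using assms by (intro cSUP_upper) auto
  then show ?thesis unfolding bellman_op_def by simp
qed

lemma bellman_op_attained:
  obtains c a where "c < m" "a \<in> {0, 1}" "bellman_op v x = A c (tau a x) + lam * v (tau a x)"
proof -
  let ?S = "(\<lambda>(c, a). A c (tau a x) + lam * v (tau a x)) ` ({..<m} \<times> {0, 1})"
  have "Sup ?S = Max ?S" "Max ?S \<in> ?S"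
    using m_pos by (auto intro!: cSup_eq_Max Max_in)
  then show thesis using that unfolding bellman_op_def by auto
qed

lemma continuous_on_bellman_op:
  assumes v: "continuous_on UNIV v"
  shows "continuous_on UNIV (bellman_op v)"
proof (rule continuous_on_circleI)
  define h where "h c y = A c y + lam * v y" for c y
  have h: "continuous_on UNIV (\<lambda>t. h c (proj (t / 2 + real a / 2)))" if "c < m" for c a
  proof -
    have "continuous_on UNIV (h c)"
      unfolding h_def by (intro continuous_intros v continuous_A that)
    moreover have "continuous_on UNIV (\<lambda>t. proj (t / 2 + real a / 2))"
      by (rule continuous_on_compose2[OF continuous_on_proj]) (auto intro!: continuous_intros)
    ultimately show ?thesis by (rule continuous_on_compose2) auto
  qed
  have "bellman_op v (proj t)
      = (SUP i\<in>{..<m} \<times> {0, 1}. h (fst i) (proj (t / 2 + real (snd i) / 2)))" for t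
  proof -
    have "(\<lambda>(c, a). h c (tau a (proj t))) ` ({..<m} \<times> {0, 1})
        = (\<Union>c<m. h c ` {tau 0 (proj t), tau 1 (proj t)})" by (auto simp: image_iff)
    also have "\<dots> = (\<lambda>i. h (fst i) (proj (t / 2 + real (snd i) / 2))) ` ({..<m} \<times> {0, 1})"
      unfolding tau_proj_set by (auto simp: image_iff)
    finally show ?thesis unfolding bellman_op_def h_def by simp
  qed
  then show "continuous_on UNIV (\<lambda>t. bellman_op v (proj t))"
    using m_pos by (auto intro!: continuous_on_SUP_finite h)
qed

text \<open>The branch that is optimal for one function is also available to the other.\<close>

lemma bellman_op_diff_le:
  assumes "\<And>y. \<bar>v y - w y\<bar> \<le> d"
  shows "bellman_op v x - bellman_op w x \<le> lam * d"
proof -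
  obtain c a where ca: "c < m" "a \<in> {0, 1}" "bellman_op v x = A c (tau a x) + lam * v (tau a x)"
    by (rule bellman_op_attained)
  have "bellman_op v x - bellman_op w x \<le> lam * (v (tau a x) - w (tau a x))"
    using ca bellman_op_ge[OF ca(1,2), of x w] by (simp add: algebra_simps)
  also have "\<dots> \<le> lam * d"
    using lam assms[of "tau a x"] by (intro mult_left_mono) auto
  finally show ?thesis .
qed

lemma bellman_op_contraction:
  assumes "\<And>y. \<bar>v y - w y\<bar> \<le> d"
  shows "\<bar>bellman_op v x - bellman_op w x\<bar> \<le> lam * d"
proof -
  have "\<bar>w y - v y\<bar> \<le> d" for y using assms[of y] by (simp add: abs_minus_commute)
  then show ?thesis
    using bellman_op_diff_le[of v w d x, OF assms] bellman_op_diff_le[of w v d x]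
    by (simp add: abs_le_iff)
qed

text \<open>Banach's fixed point theorem in the space of bounded continuous functions; on the compact circle
  boundedness is automatic, so uniqueness holds among all continuous functions.\<close>

lemma ex1_bellman_solution: "\<exists>!v. bellman_solution m A lam v"
proof -
  have mem: "f \<in> bcontfun" if "continuous_on UNIV f" for f :: "circle \<Rightarrow> real"
    using that bounded_range_circle by (auto simp: bcontfun_def)
  define \<Phi> :: "(circle \<Rightarrow>\<^sub>C real) \<Rightarrow> (circle \<Rightarrow>\<^sub>C real)"
    where "\<Phi> u = Bcontfun (bellman_op (apply_bcontfun u))" for u
  have \<Phi>: "apply_bcontfun (\<Phi> u) = bellman_op (apply_bcontfun u)" for u
    unfolding \<Phi>_def by (intro Bcontfun_inverse mem continuous_on_bellman_op) simp
  have "dist (\<Phi> u) (\<Phi> w) \<le> lam * dist u w" for u w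
    using dist_bounded[of u _ w]
    by (intro dist_bound) (auto simp: \<Phi> dist_real_def intro!: bellman_op_contraction)
  then have "\<exists>!u. \<Phi> u = u"
    using lam by (intro banach_fix_type[of lam]) auto
  then obtain u where u: "\<Phi> u = u" "\<And>u'. \<Phi> u' = u' \<Longrightarrow> u' = u" by blast
  show ?thesis
  proof (rule ex1I)
    show "bellman_solution m A lam (apply_bcontfun u)"
      unfolding bellman_solution_iff using \<Phi>[of u] u(1) by (metis continuous_on_apply_bcontfun)
    fix w assume w: "bellman_solution m A lam w"
    then obtain u' where u': "w = apply_bcontfun u'"
      using mem bcontfunE unfolding bellman_solution_iff by metis
    have "\<Phi> u' = u'"
      using w u' unfolding bellman_solution_iff by (intro bcontfun_eqI) (simp add: \<Phi>)
    then show "w = apply_bcontfun u" using u(2) u' by simp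
  qed
qed

definition V :: "circle \<Rightarrow> real" where "V = v_lam m A lam"

lemma bellman_solution_V: "bellman_solution m A lam V"
  unfolding V_def v_lam_def by (rule theI'[OF ex1_bellman_solution])

lemma continuous_V: "continuous_on UNIV V"
  using bellman_solution_V unfolding bellman_solution_iff by blast

lemma V_eq: "V x = bellman_op V x"
  using bellman_solution_V unfolding bellman_solution_iff by blast

lemma V_ge:
  assumes "c < m" "a \<in> {0, 1}"
  shows "A c (tau a x) + lam * V (tau a x) \<le> V x"
  unfolding V_eq[of x] using assms by (rule bellman_op_ge)

lemma V_attained:
  obtains c a where "c < m" "a \<in> {0, 1}" "V x = A c (tau a x) + lam * V (tau a x)"
  unfolding V_eq[of x] by (rule bellman_op_attained)

lemma A_bounded:
  obtains B where "\<And>c x. c < m \<Longrightarrow> \<bar>A c x\<bar> \<le> B"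
proof -
  have "bounded (\<Union>c<m. range (A c))"
    using bounded_range_circle[OF continuous_A] by (intro bounded_UN) auto
  then obtain B where B: "0 < B" "\<And>y. y \<in> (\<Union>c<m. range (A c)) \<Longrightarrow> norm y \<le> B"
    unfolding bounded_pos by blast
  show thesis by (rule that[of B]) (use B in force)
qed

text \<open>The loss incurred by choosing colour \<open>c\<close> and branch \<open>a\<close> at \<open>x\<close> instead of an optimal
  choice, with a negative sign: the Bellman equation says exactly that the largest slack at each
  point is \<open>0\<close>.\<close>

definition slack :: "nat \<Rightarrow> nat \<Rightarrow> circle \<Rightarrow> real" where
  "slack c a x = A c (tau a x) + disc_diff lam V x a"

lemma slack_nonpos: "c < m \<Longrightarrow> a \<in> {0, 1} \<Longrightarrow> slack c a x \<le> 0"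
  using V_ge[of c a x] by (simp add: slack_def disc_diff_def)

end


section \<open>The superior boundary\<close>

context discounted_skew_ifs
begin

lemma summable_S:
  assumes "range c \<subseteq> {..<m}"
  shows "summable (\<lambda>i. lam ^ i * A (c i) (tau_iter a i x))"
proof -
  obtain B where B: "\<And>c x. c < m \<Longrightarrow> \<bar>A c x\<bar> \<le> B" by (rule A_bounded) blast
  have "summable (\<lambda>i. lam ^ i * B)"
    using lam by (intro summable_mult2 summable_geometric) auto
  moreover have "norm (lam ^ i * A (c i) (tau_iter a i x)) \<le> lam ^ i * B" for i
    using lam B[of "c i"] assms by (auto simp: abs_mult intro!: mult_left_mono)
  ultimately show ?thesis by (rule summable_comparison_test'[where N = 0])
qed

text \<open>Along a backward orbit the differences \<open>disc_diff\<close> of \<open>V\<close>, weighted by the powers of \<open>lam\<close>,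
  telescope to \<open>- V x\<close>.  So the discounted value of an itinerary falls short of \<open>V x\<close> by the
  discounted sum of its losses.\<close>

lemma sums_S_minus_V:
  fixes x :: circle and a :: "nat \<Rightarrow> nat"
  assumes c: "range c \<subseteq> {..<m}"
  defines "y \<equiv> \<lambda>i. case i of 0 \<Rightarrow> x | Suc j \<Rightarrow> tau_iter a j x"
  shows "(\<lambda>i. lam ^ i * slack (c i) (a i) (y i)) sums (S A lam x c a - V x)"
proof -
  have y_Suc: "tau (a i) (y i) = y (Suc i)" for i
    by (cases i) (simp_all add: y_def)
  obtain B where B: "\<And>x. \<bar>V x\<bar> \<le> B"
    using bounded_circle_functionE[OF continuous_V] by metis
  have lim: "(\<lambda>n. lam ^ n * V (y n)) \<longlonglongrightarrow> 0"
  proof (rule tendsto_0_le[where K = B])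
    show "(\<lambda>n. lam ^ n) \<longlonglongrightarrow> 0" using lam by (intro LIMSEQ_power_zero) auto
    show "\<forall>\<^sub>F n in sequentially. norm (lam ^ n * V (y n)) \<le> norm (lam ^ n) * B"
      using B by (intro always_eventually) (auto simp: abs_mult intro!: mult_left_mono)
  qed
  have "(\<lambda>i. lam ^ Suc i * V (y (Suc i)) - lam ^ i * V (y i)) sums (0 - lam ^ 0 * V (y 0))"
    by (rule telescope_sums[OF lim])
  moreover have "(\<lambda>i. lam ^ i * A (c i) (tau_iter a i x)) sums S A lam x c a"
    unfolding S_def using summable_sums[OF summable_S[OF c]] .
  ultimately have "(\<lambda>i. lam ^ i * A (c i) (tau_iter a i x)
      + (lam ^ Suc i * V (y (Suc i)) - lam ^ i * V (y i))) sums
      (S A lam x c a + (0 - lam ^ 0 * V (y 0)))"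
    by (intro sums_add)
  moreover have "lam ^ i * slack (c i) (a i) (y i) = lam ^ i * A (c i) (tau_iter a i x)
      + (lam ^ Suc i * V (y (Suc i)) - lam ^ i * V (y i))" for i
    unfolding slack_def disc_diff_def y_Suc by (simp add: y_def algebra_simps)
  ultimately show ?thesis by (simp add: y_def)
qed

lemma S_le_V:
  assumes "range c \<subseteq> {..<m}" "range a \<subseteq> {0, 1}"
  shows "S A lam x c a \<le> V x"
proof -
  have "lam ^ i * slack (c i) (a i) z \<le> 0" for i z
    using lam slack_nonpos[of "c i" "a i" z] assms by (auto intro!: mult_nonneg_nonpos)
  then have "S A lam x c a - V x \<le> 0"
    using sums_le[OF _ sums_S_minus_V[OF assms(1), of a x] sums_zero] by blast
  then show ?thesis by simp
qed

text \<open>Choosing at each point of the backward orbit a colour and a branch without loss makes every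
  term of the preceding series vanish.\<close>

lemma V_eq_S:
  obtains c a where "range c \<subseteq> {..<m}" "range a \<subseteq> {0, 1}" "V x = S A lam x c a"
proof -
  have "\<forall>y. \<exists>c a. c < m \<and> a \<in> {0, 1} \<and> slack c a y = 0"
    using V_attained unfolding slack_def disc_diff_def
    by (metis add_diff_eq diff_self)
  then obtain C \<alpha> where C: "\<And>y. C y < m" "\<And>y. \<alpha> y \<in> {0, 1}" "\<And>y. slack (C y) (\<alpha> y) y = 0"
    by metis
  \<comment> \<open>\<open>tau_iter\<close> starts counting after one step, so \<open>y (Suc i)\<close> is its value at \<open>i\<close>.\<close>
  define y where "y i = ((\<lambda>z. tau (\<alpha> z) z) ^^ i) x" for i
  have ti: "tau_iter (\<lambda>i. \<alpha> (y i)) i x = y (Suc i)" for i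
    by (induction i) (simp_all add: y_def)
  have "(case i of 0 \<Rightarrow> x | Suc j \<Rightarrow> tau_iter (\<lambda>i. \<alpha> (y i)) j x) = y i" for i
    by (cases i) (simp_all only: ti nat.case, simp add: y_def)
  moreover have "range (\<lambda>i. C (y i)) \<subseteq> {..<m}" using C(1) by auto
  ultimately have "(\<lambda>i. 0) sums (S A lam x (\<lambda>i. C (y i)) (\<lambda>i. \<alpha> (y i)) - V x)"
    using sums_S_minus_V[of "\<lambda>i. C (y i)" "\<lambda>i. \<alpha> (y i)" x] C(3) by simp
  then have "S A lam x (\<lambda>i. C (y i)) (\<lambda>i. \<alpha> (y i)) - V x = 0"
    using sums_unique2 sums_zero by blast
  moreover have "range (\<lambda>i. \<alpha> (y i)) \<subseteq> {0, 1}"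
    by (rule image_subsetI) (rule C(2))
  ultimately show thesis
    using \<open>range (\<lambda>i. C (y i)) \<subseteq> _\<close> that by simp
qed

lemma superior_boundary_eq: "superior_boundary (Lam m A lam) = {(x, V x) |x. True}"
proof -
  have mem: "(x, V x) \<in> Lam m A lam" for x
    by (rule V_eq_S[of x]) (auto simp: Lam_def)
  have le: "y \<le> V x" if "(x, y) \<in> Lam m A lam" for x y
    using that by (auto simp: Lam_def intro!: S_le_V)
  show ?thesis
    unfolding superior_boundary_def by (auto intro!: antisym mem le)
qed

end


section \<open>Discounted occupation measures\<close>

text \<open>A geometric time is \<open>0\<close> with probability \<open>p\<close> and otherwise one more than a geometric time.\<close>

lemma expectation_geometric_pmf_shift:
  fixes g :: "nat \<Rightarrow> real"
  assumes p: "0 < p" "p < 1" and g: "\<And>n. \<bar>g n\<bar> \<le> B"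
  shows "measure_pmf.expectation (geometric_pmf p) g
    = p * g 0 + (1 - p) * measure_pmf.expectation (geometric_pmf p) (\<lambda>n. g (Suc n))"
proof -
  have exp: "measure_pmf.expectation (geometric_pmf p) h = (\<Sum>n. (1 - p) ^ n * p * h n)"
    and sum: "summable (\<lambda>n. (1 - p) ^ n * p * h n)"
    if h: "\<And>n. \<bar>h n\<bar> \<le> B" for h :: "nat \<Rightarrow> real"
  proof -
    have "summable (\<lambda>n. (1 - p) ^ n * (p * B))"
      using p by (intro summable_mult2 summable_geometric) auto
    moreover have "norm (norm ((1 - p) ^ n * p * h n)) \<le> (1 - p) ^ n * (p * B)" for n
      using p h[of n] by (simp add: abs_mult mult.assoc mult_left_mono)
    ultimately have "summable (\<lambda>n. norm ((1 - p) ^ n * p * h n))"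
      by (rule summable_comparison_test'[where N = 0])
    then show "summable (\<lambda>n. (1 - p) ^ n * p * h n)" by (rule summable_norm_cancel)
    have "measure_pmf.expectation (geometric_pmf p) h
        = (\<integral>n. (1 - p) ^ n * p * h n \<partial>count_space UNIV)"
      unfolding measure_pmf_eq_density using p by (subst integral_density) auto
    also have "\<dots> = (\<Sum>n. (1 - p) ^ n * p * h n)"
      using \<open>summable (\<lambda>n. norm _)\<close>
      by (intro integral_count_space_nat) (simp add: integrable_count_space_nat_iff)
    finally show "measure_pmf.expectation (geometric_pmf p) h = (\<Sum>n. (1 - p) ^ n * p * h n)" .
  qed
  have "(\<Sum>n. (1 - p) ^ Suc n * p * g (Suc n)) = (1 - p) * (\<Sum>n. (1 - p) ^ n * p * g (Suc n))"
    using sum[of "\<lambda>n. g (Suc n)"] g by (subst suminf_mult[symmetric]) (auto simp: mult.assoc)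
  then show ?thesis
    using suminf_split_head[OF sum[of g]] g exp[of g] exp[of "\<lambda>n. g (Suc n)"] by simp
qed

text \<open>The law of the orbit of \<open>F\<close>, started with distribution \<open>M\<close> and observed at an independent
  geometric time: the discounted average \<open>p (\<Sum>n. (1 - p)^n F^n M)\<close> of the push-forwards.\<close>

definition discounted_occupation ::
    "real \<Rightarrow> ('a \<Rightarrow> 'a) \<Rightarrow> 'a measure \<Rightarrow> 'a measure" where
  "discounted_occupation p F M =
    distr (M \<Otimes>\<^sub>M measure_pmf (geometric_pmf p)) M (\<lambda>(x, n). (F ^^ n) x)"

lemma measurable_iterate:
  assumes F: "F \<in> M \<rightarrow>\<^sub>M M"
  shows "(\<lambda>(x, n). (F ^^ n) x) \<in> M \<Otimes>\<^sub>M measure_pmf q \<rightarrow>\<^sub>M M"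
proof -
  have pow: "(\<lambda>x. (F ^^ n) x) \<in> M \<rightarrow>\<^sub>M M" for n
    by (induction n) (auto intro: measurable_compose[OF _ F])
  have "(\<lambda>y. (\<lambda>i y. (F ^^ i) (fst y)) (snd y) y) \<in> M \<Otimes>\<^sub>M measure_pmf q \<rightarrow>\<^sub>M M"
  proof (rule measurable_compose_countable)
    show "(\<lambda>y. (F ^^ i) (fst y)) \<in> M \<Otimes>\<^sub>M measure_pmf q \<rightarrow>\<^sub>M M" for i
      by (rule measurable_compose[OF measurable_fst pow])
    have "snd \<in> M \<Otimes>\<^sub>M measure_pmf q \<rightarrow>\<^sub>M measure_pmf q" by (rule measurable_snd)
    then show "snd \<in> M \<Otimes>\<^sub>M measure_pmf q \<rightarrow>\<^sub>M count_space UNIV"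
      by (simp cong: measurable_cong_sets)
  qed
  then show ?thesis by (simp add: case_prod_beta)
qed

lemma discounted_occupation_in_prob_algebra:
  assumes "prob_space M" "F \<in> M \<rightarrow>\<^sub>M M"
  shows "prob_space (discounted_occupation p F M)" "sets (discounted_occupation p F M) = sets M"
proof -
  interpret prob_space M by fact
  interpret pair_prob_space M "measure_pmf (geometric_pmf p)" ..
  show "prob_space (discounted_occupation p F M)"
    unfolding discounted_occupation_def
    by (rule P.prob_space_distr[OF measurable_iterate[OF assms(2)]])
qed (simp add: discounted_occupation_def)

text \<open>With \<open>p = 1 - lam\<close> this invariance up to an injection of mass from \<open>M\<close> is the discounted
  holonomy condition with trace \<open>M\<close>.\<close>

lemma integral_discounted_occupation:
  fixes w :: "'a \<Rightarrow> real"
  assumes M: "prob_space M" and F: "F \<in> M \<rightarrow>\<^sub>M M" and p: "0 < p" "p < 1"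
    and w: "w \<in> borel_measurable M" and B: "\<And>x. \<bar>w x\<bar> \<le> B"
  shows "integral\<^sup>L (discounted_occupation p F M) w =
    p * integral\<^sup>L M w + (1 - p) * integral\<^sup>L (discounted_occupation p F M) (\<lambda>x. w (F x))"
proof -
  interpret M: prob_space M by (rule M)
  interpret pair_prob_space M "measure_pmf (geometric_pmf p)" ..
  let ?E = "measure_pmf.expectation (geometric_pmf p)"
  have int: "integrable (M \<Otimes>\<^sub>M measure_pmf (geometric_pmf p)) (\<lambda>(x, n). h ((F ^^ n) x))"
    if "h \<in> borel_measurable M" "\<And>x. \<bar>h x\<bar> \<le> B" for h :: "'a \<Rightarrow> real"
    using measurable_compose[OF measurable_iterate[OF F] that(1)] that(2)
    by (intro P.integrable_const_bound[where B = B]) (auto simp: case_prod_beta)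
  have occ: "integral\<^sup>L (discounted_occupation p F M) h = (\<integral>x. ?E (\<lambda>n. h ((F ^^ n) x)) \<partial>M)"
    if "h \<in> borel_measurable M" "\<And>x. \<bar>h x\<bar> \<le> B" for h :: "'a \<Rightarrow> real"
    unfolding discounted_occupation_def integral_distr[OF measurable_iterate[OF F] that(1)]
    using integral_fst[OF int[OF that]] by (simp add: case_prod_unfold)
  have wF: "(\<lambda>x. w (F x)) \<in> borel_measurable M" by (rule measurable_compose[OF F w])
  have "integral\<^sup>L (discounted_occupation p F M) w
      = (\<integral>x. p * w x + (1 - p) * ?E (\<lambda>n. w (F ((F ^^ n) x))) \<partial>M)"
    unfolding occ[OF w B]
    by (subst expectation_geometric_pmf_shift[OF p, of _ B]) (use B in auto)
  also have "\<dots> = p * integral\<^sup>L M w + (1 - p) * (\<integral>x. ?E (\<lambda>n. w (F ((F ^^ n) x))) \<partial>M)"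
    using integrable_fst[OF int[OF wF B]] M.integrable_const_bound[of w B] w B
    by (subst Bochner_Integration.integral_add) auto
  also have "(\<integral>x. ?E (\<lambda>n. w (F ((F ^^ n) x))) \<partial>M)
      = integral\<^sup>L (discounted_occupation p F M) (\<lambda>x. w (F x))"
    by (rule occ[OF wF B, symmetric])
  finally show ?thesis .
qed


section \<open>Holonomic probabilities and maximality\<close>

text \<open>A function on \<open>X \<times> C \<times> I\<close> need only be measurable in \<open>x\<close>, as there are finitely many
  colours and branches.\<close>

lemma measurable_XCI:
  assumes "\<And>c a. c < m \<Longrightarrow> a \<in> {0, 1} \<Longrightarrow> f c a \<in> borel \<rightarrow>\<^sub>M N"
  shows "(\<lambda>(x, c, a). f c a x) \<in> XCI m \<rightarrow>\<^sub>M N"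
proof -
  have pair: "count_space {..<m} \<Otimes>\<^sub>M count_space {0, 1} = count_space ({..<m} \<times> {0, 1::nat})"
    by (rule pair_measure_countable) auto
  have "(\<lambda>p. (\<lambda>i p. f (fst i) (snd i) (fst p)) (snd p) p) \<in> XCI m \<rightarrow>\<^sub>M N"
  proof (rule measurable_compose_countable'[where I = "{..<m} \<times> {0, 1}"])
    show "(\<lambda>p. f (fst i) (snd i) (fst p)) \<in> XCI m \<rightarrow>\<^sub>M N" if "i \<in> {..<m} \<times> {0, 1}" for i
      unfolding XCI_def by (rule measurable_compose[OF measurable_fst assms]) (use that in auto)
    show "snd \<in> XCI m \<rightarrow>\<^sub>M count_space ({..<m} \<times> {0, 1})"
      unfolding XCI_def by (subst pair[symmetric]) (rule measurable_snd)
  qed auto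
  then show ?thesis by (simp add: case_prod_beta)
qed

lemma integrable_XCI:
  fixes f :: "nat \<Rightarrow> nat \<Rightarrow> circle \<Rightarrow> real"
  assumes "prob_space \<mu>" "sets \<mu> = sets (XCI m)"
    and "\<And>c a. c < m \<Longrightarrow> a \<in> {0, 1} \<Longrightarrow> f c a \<in> borel_measurable borel"
    and "\<And>c a x. c < m \<Longrightarrow> a \<in> {0, 1} \<Longrightarrow> \<bar>f c a x\<bar> \<le> B"
  shows "integrable \<mu> (\<lambda>(x, c, a). f c a x)"
proof -
  interpret prob_space \<mu> by fact
  have "space \<mu> = UNIV \<times> {..<m} \<times> {0, 1}"
    using sets_eq_imp_space_eq[OF assms(2)] by (simp add: space_XCI)
  then have "AE p in \<mu>. norm (case p of (x, c, a) \<Rightarrow> f c a x) \<le> B"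
    using assms(4) by (intro AE_I2) auto
  moreover have "(\<lambda>(x, c, a). f c a x) \<in> borel_measurable \<mu>"
    unfolding measurable_cong_sets[OF assms(2) refl] by (rule measurable_XCI[OF assms(3)])
  ultimately show ?thesis by (rule integrable_const_bound)
qed

lemma measurable_comp_tau:
  assumes "continuous_on UNIV (w :: circle \<Rightarrow> real)"
  shows "(\<lambda>x. w (tau a x)) \<in> borel_measurable borel"
  by (rule measurable_compose[OF borel_measurable_tau borel_measurable_continuous_onI[OF assms]])

context discounted_skew_ifs
begin

lemma holonomicD:
  assumes "\<mu> \<in> holonomic m lam \<nu>"
  shows "prob_space \<mu>" "sets \<mu> = sets (XCI m)" "space \<mu> = UNIV \<times> {..<m} \<times> {0, 1}"
    and "\<And>w. continuous_on UNIV w \<Longrightarrow>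
      integral\<^sup>L \<mu> (\<lambda>(x, c, a). disc_diff lam w x a) = - (1 - lam) * integral\<^sup>L \<nu> w"
proof -
  have *: "prob_space \<mu>" "sets \<mu> = sets (XCI m)" "\<forall>w. continuous_on UNIV w \<longrightarrow>
      integral\<^sup>L \<mu> (\<lambda>(x, c, a). disc_diff lam w x a) = - (1 - lam) * integral\<^sup>L \<nu> w"
    using assms unfolding holonomic_def space_prob_algebra by blast+
  show "prob_space \<mu>" "sets \<mu> = sets (XCI m)" by (fact *)+
  show "space \<mu> = UNIV \<times> {..<m} \<times> {0, 1}"
    using sets_eq_imp_space_eq[OF *(2)] by (simp only: space_XCI)
  show "integral\<^sup>L \<mu> (\<lambda>(x, c, a). disc_diff lam w x a) = - (1 - lam) * integral\<^sup>L \<nu> w"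
    if "continuous_on UNIV w" for w
    using *(3) that by blast
qed

lemma measurable_disc_diff:
  assumes "continuous_on UNIV w"
  shows "(\<lambda>x. disc_diff lam w x a) \<in> borel_measurable borel"
  unfolding disc_diff_def
  using measurable_comp_tau[OF assms] borel_measurable_continuous_onI[OF assms] by auto

lemma measurable_slack: "c < m \<Longrightarrow> slack c a \<in> borel_measurable borel"
  unfolding slack_def
  using measurable_comp_tau[OF continuous_A] measurable_disc_diff[OF continuous_V] by auto

lemma measurable_slack_XCI: "(\<lambda>(x, c, a). slack c a x) \<in> borel_measurable (XCI m)"
  by (rule measurable_XCI[OF measurable_slack])

text \<open>Testing holonomy against \<open>V\<close> itself replaces the payoff by the slack, up to a constant that
  depends on the trace only.\<close>

lemma integral_payoff:
  assumes \<mu>: "\<mu> \<in> holonomic m lam \<nu>"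
  shows "integrable \<mu> (\<lambda>(x, c, a). slack c a x)"
    and "integral\<^sup>L \<mu> (\<lambda>(x, c, a). A c (tau a x)) =
      (1 - lam) * integral\<^sup>L \<nu> V + integral\<^sup>L \<mu> (\<lambda>(x, c, a). slack c a x)"
proof -
  note \<mu>D = holonomicD[OF \<mu>]
  obtain B where B: "\<And>c x. c < m \<Longrightarrow> \<bar>A c x\<bar> \<le> B" by (rule A_bounded) blast
  obtain B' where B': "\<And>x. \<bar>V x\<bar> \<le> B'"
    using bounded_circle_functionE[OF continuous_V] by metis
  have intA: "integrable \<mu> (\<lambda>(x, c, a). A c (tau a x))"
    by (rule integrable_XCI[OF \<mu>D(1,2) measurable_comp_tau[OF continuous_A] B])
  have "\<bar>disc_diff lam V x a\<bar> \<le> lam * B' + B'" for x a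
  proof -
    have "\<bar>lam * V (tau a x)\<bar> \<le> lam * B'"
      using lam B'[of "tau a x"] by (simp add: abs_mult mult_left_mono)
    then show ?thesis
      using B'[of x] unfolding disc_diff_def by linarith
  qed
  then have intd: "integrable \<mu> (\<lambda>(x, c, a). disc_diff lam V x a)"
    by (intro integrable_XCI[OF \<mu>D(1,2) measurable_disc_diff[OF continuous_V]])
  have split: "(\<lambda>(x, c, a). slack c a x)
      = (\<lambda>p. (case p of (x, c, a) \<Rightarrow> A c (tau a x)) + (case p of (x, c, a) \<Rightarrow> disc_diff lam V x a))"
    by (auto simp: slack_def)
  show "integrable \<mu> (\<lambda>(x, c, a). slack c a x)"
    unfolding split by (rule Bochner_Integration.integrable_add[OF intA intd])
  show "integral\<^sup>L \<mu> (\<lambda>(x, c, a). A c (tau a x)) =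
      (1 - lam) * integral\<^sup>L \<nu> V + integral\<^sup>L \<mu> (\<lambda>(x, c, a). slack c a x)"
    unfolding split Bochner_Integration.integral_add[OF intA intd]
    using \<mu>D(4)[OF continuous_V] by (simp add: algebra_simps)
qed

lemma integral_slack:
  assumes \<mu>: "\<mu> \<in> holonomic m lam \<nu>"
  shows "integral\<^sup>L \<mu> (\<lambda>(x, c, a). slack c a x) \<le> 0"
    and "integral\<^sup>L \<mu> (\<lambda>(x, c, a). slack c a x) = 0 \<longleftrightarrow> (AE (x, c, a) in \<mu>. slack c a x = 0)"
proof -
  note \<mu>D = holonomicD[OF \<mu>]
  have ae: "AE p in \<mu>. 0 \<le> - (case p of (x, c, a) \<Rightarrow> slack c a x)"
    using slack_nonpos by (intro AE_I2) (auto simp: \<mu>D(3))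
  have "0 \<le> integral\<^sup>L \<mu> (\<lambda>p. - (case p of (x, c, a) \<Rightarrow> slack c a x))"
    by (rule integral_nonneg_AE[OF ae])
  then show "integral\<^sup>L \<mu> (\<lambda>(x, c, a). slack c a x) \<le> 0" by simp
  show "integral\<^sup>L \<mu> (\<lambda>(x, c, a). slack c a x) = 0 \<longleftrightarrow> (AE (x, c, a) in \<mu>. slack c a x = 0)"
    using integral_nonneg_eq_0_iff_AE[OF _ ae] integral_payoff(1)[OF \<mu>]
    by (simp add: case_prod_unfold)
qed

text \<open>Any measurable rule for choosing a colour and a branch gives a holonomic probability carried by
  the graph of the rule: occupy the circle according to the backward dynamics that the rule selects.\<close>

lemma strategy_measure_holonomic:
  assumes \<nu>: "prob_space \<nu>" "sets \<nu> = sets borel"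
    and C: "C \<in> borel \<rightarrow>\<^sub>M count_space {..<m}" and \<alpha>: "\<alpha> \<in> borel \<rightarrow>\<^sub>M count_space {0, 1}"
  defines "\<rho> \<equiv> discounted_occupation (1 - lam) (\<lambda>x. tau (\<alpha> x) x) \<nu>"
  shows "distr \<rho> (XCI m) (\<lambda>x. (x, C x, \<alpha> x)) \<in> holonomic m lam \<nu>"
    and "(\<lambda>x. (x, C x, \<alpha> x)) \<in> \<rho> \<rightarrow>\<^sub>M XCI m"
proof -
  have F: "(\<lambda>x. tau (\<alpha> x) x) \<in> \<nu> \<rightarrow>\<^sub>M \<nu>"
    using measurable_compose_countable'[OF borel_measurable_tau \<alpha>] \<nu>(2)
    by (simp cong: measurable_cong_sets)
  have \<rho>: "prob_space \<rho>" "sets \<rho> = sets borel"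
    using discounted_occupation_in_prob_algebra[OF \<nu>(1) F] \<nu>(2) by (simp_all add: \<rho>_def)
  have "(\<lambda>x. (x, C x, \<alpha> x)) \<in> borel \<rightarrow>\<^sub>M XCI m"
    unfolding XCI_def using C \<alpha> by measurable
  then show g: "(\<lambda>x. (x, C x, \<alpha> x)) \<in> \<rho> \<rightarrow>\<^sub>M XCI m"
    using \<rho>(2) by (simp cong: measurable_cong_sets)
  have "integral\<^sup>L (distr \<rho> (XCI m) (\<lambda>x. (x, C x, \<alpha> x))) (\<lambda>(x, c, a). disc_diff lam w x a)
      = - (1 - lam) * integral\<^sup>L \<nu> w" if w: "continuous_on UNIV w" for w
  proof -
    obtain B where B: "\<And>x. \<bar>w x\<bar> \<le> B"
      using bounded_circle_functionE[OF w] by metis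
    have wm: "w \<in> borel_measurable \<nu>"
      using borel_measurable_continuous_onI[OF w] \<nu>(2) by (simp cong: measurable_cong_sets)
    have wm': "w \<in> borel_measurable \<rho>" "(\<lambda>x. w (tau (\<alpha> x) x)) \<in> borel_measurable \<rho>"
      using wm measurable_compose[OF F wm] \<nu>(2) \<rho>(2) by (simp_all cong: measurable_cong_sets)
    interpret \<rho>: prob_space \<rho> by (rule \<rho>)
    have int: "integrable \<rho> w" "integrable \<rho> (\<lambda>x. w (tau (\<alpha> x) x))"
      using wm' B by (auto intro!: \<rho>.integrable_const_bound[where B = B])
    have "integral\<^sup>L (distr \<rho> (XCI m) (\<lambda>x. (x, C x, \<alpha> x))) (\<lambda>(x, c, a). disc_diff lam w x a)
        = (\<integral>x. lam * w (tau (\<alpha> x) x) - w x \<partial>\<rho>)"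
      by (subst integral_distr[OF g measurable_XCI[OF measurable_disc_diff[OF w]]])
        (simp add: disc_diff_def)
    also have "\<dots> = lam * (\<integral>x. w (tau (\<alpha> x) x) \<partial>\<rho>) - integral\<^sup>L \<rho> w"
      using int by simp
    also have "\<dots> = - (1 - lam) * integral\<^sup>L \<nu> w"
      unfolding \<rho>_def using integral_discounted_occupation[OF \<nu>(1) F _ _ wm B, of "1 - lam"] lam
      by (simp add: algebra_simps)
    finally show ?thesis .
  qed
  then show "distr \<rho> (XCI m) (\<lambda>x. (x, C x, \<alpha> x)) \<in> holonomic m lam \<nu>"
    using prob_space.prob_space_distr[OF \<rho>(1) g]
    unfolding holonomic_def space_prob_algebra by simp
qed

text \<open>Among the finitely many optimal choices at a point the first in a fixed enumeration depends
  measurably on the point.\<close>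

lemma measurable_optimal_strategy:
  obtains C \<alpha> where "C \<in> borel \<rightarrow>\<^sub>M count_space {..<m}" "\<alpha> \<in> borel \<rightarrow>\<^sub>M count_space {0, 1}"
    "\<And>x. slack (C x) (\<alpha> x) x = 0"
proof -
  \<comment> \<open>The pair \<open>(c, a)\<close> has the number \<open>2 * c + a\<close>.\<close>
  define P where "P k x \<longleftrightarrow> k div 2 < m \<and> slack (k div 2) (k mod 2) x = 0" for k x
  define \<kappa> where "\<kappa> x = (LEAST k. P k x)" for x
  have ex: "\<exists>k. P k x" for x
  proof -
    obtain c a where ca: "c < m" "a \<in> {0, 1}" "V x = A c (tau a x) + lam * V (tau a x)"
      by (rule V_attained)
    then have "P (2 * c + a) x" by (auto simp: P_def slack_def disc_diff_def)
    then show ?thesis ..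
  qed
  have P\<kappa>: "P (\<kappa> x) x" for x unfolding \<kappa>_def by (rule LeastI_ex[OF ex])
  have "Measurable.pred borel (P k)" for k
  proof (cases "k div 2 < m")
    case True
    note [measurable] = measurable_slack[OF True]
    show ?thesis unfolding P_def by measurable
  next
    case False
    then have "P k = (\<lambda>_. False)" by (auto simp: P_def fun_eq_iff)
    then show ?thesis by simp
  qed
  then have \<kappa>: "\<kappa> \<in> borel \<rightarrow>\<^sub>M count_space UNIV"
    unfolding \<kappa>_def by (rule measurable_Least)
  have "(\<lambda>x. \<kappa> x div 2) \<in> borel \<rightarrow>\<^sub>M count_space UNIV" "(\<lambda>x. \<kappa> x mod 2) \<in> borel \<rightarrow>\<^sub>M count_space UNIV"
    using measurable_compose[OF \<kappa>, of _ "count_space UNIV"] by auto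
  then show thesis
    using P\<kappa> by (intro that[of "\<lambda>x. \<kappa> x div 2" "\<lambda>x. \<kappa> x mod 2"])
      (auto simp: P_def measurable_count_space_eq2_countable)
qed

lemma ex_holonomic_slack_zero:
  assumes \<nu>: "prob_space \<nu>" "sets \<nu> = sets borel"
  obtains \<mu> where "\<mu> \<in> holonomic m lam \<nu>" "integral\<^sup>L \<mu> (\<lambda>(x, c, a). slack c a x) = 0"
proof -
  obtain C \<alpha> where C: "C \<in> borel \<rightarrow>\<^sub>M count_space {..<m}" "\<alpha> \<in> borel \<rightarrow>\<^sub>M count_space {0, 1}"
    and z: "\<And>x. slack (C x) (\<alpha> x) x = 0"
    by (rule measurable_optimal_strategy) blast
  note * = strategy_measure_holonomic[OF \<nu> C]
  show thesis
    by (rule that[OF *(1)], subst integral_distr[OF *(2) measurable_slack_XCI]) (simp add: z)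
qed

text \<open>The supremum of the payoffs is \<open>(1 - lam) * integral\<^sup>L \<nu> V\<close>, attained by an optimal strategy, so the
  maximizing measures are those whose integrated slack is \<open>0\<close>; and the slack has a sign.\<close>

lemma maximizing_iff_AE:
  assumes \<nu>: "prob_space \<nu>" "sets \<nu> = sets borel" and \<mu>: "\<mu> \<in> holonomic m lam \<nu>"
  shows "maximizing m A lam \<nu> \<mu> \<longleftrightarrow> (AE (x, c, a) in \<mu>. slack c a x = 0)"
proof -
  obtain \<mu>' where \<mu>': "\<mu>' \<in> holonomic m lam \<nu>" "integral\<^sup>L \<mu>' (\<lambda>(x, c, a). slack c a x) = 0"
    by (rule ex_holonomic_slack_zero[OF \<nu>])
  have "(SUP \<mu>\<in>holonomic m lam \<nu>. integral\<^sup>L \<mu> (\<lambda>(x, c, a). A c (tau a x)))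
      = (1 - lam) * integral\<^sup>L \<nu> V"
  proof (rule cSup_eq_maximum)
    show "(1 - lam) * integral\<^sup>L \<nu> V
        \<in> (\<lambda>\<mu>. integral\<^sup>L \<mu> (\<lambda>(x, c, a). A c (tau a x))) ` holonomic m lam \<nu>"
      using integral_payoff(2)[OF \<mu>'(1)] \<mu>' by (intro image_eqI[of _ _ \<mu>']) auto
  qed (use integral_payoff(2) integral_slack(1) in fastforce)
  then show ?thesis
    unfolding maximizing_def integral_slack(2)[OF \<mu>, symmetric]
    using integral_payoff(2)[OF \<mu>] \<mu> by auto
qed

text \<open>Expressed in the representative \<open>t\<close>, the slack is a continuous function on the whole line.\<close>

lemma openin_slack_nonzero:
  "openin (rep_top m) {(x, c, a). c \<in> {..<m} \<and> a \<in> {0, 1} \<and> slack c a x \<noteq> 0}"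
  (is "openin _ ?U")
  unfolding openin_rep_top_iff
proof (intro conjI allI)
  fix c a
  define g where "g t = A c (proj (t / 2 + real a / 2))
    + (lam * V (proj (t / 2 + real a / 2)) - V (proj t))" for t
  have slack: "slack c a x = g (rep x)" for x
    by (simp add: g_def slack_def disc_diff_def tau_def proj_rep)
  show "\<exists>W. open W \<and> {x. (x, c, a) \<in> ?U} = rep -` W"
  proof (cases "c < m \<and> a \<in> {0, 1}")
    case True
    have pr: "continuous_on UNIV (\<lambda>t. proj (t / 2 + real a / 2))"
      by (rule continuous_on_compose2[OF continuous_on_proj]) (auto intro!: continuous_intros)
    have "continuous_on UNIV g"
      unfolding g_def using True
      by (intro continuous_intros continuous_on_compose2[OF continuous_A pr]
          continuous_on_compose2[OF continuous_V pr]
          continuous_on_compose2[OF continuous_V continuous_on_proj]) auto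
    then have "open (g -` (- {0}))"
      by (intro open_vimage) auto
    moreover have "{x. (x, c, a) \<in> ?U} = rep -` g -` (- {0})"
      using True by (auto simp: slack)
    ultimately show ?thesis by blast
  next
    case False
    then have "{x. (x, c, a) \<in> ?U} = rep -` {}" by auto
    then show ?thesis by blast
  qed
qed auto

lemma supp_rep_top_subset_zero_set_iff:
  assumes \<mu>: "\<mu> \<in> holonomic m lam \<nu>"
  shows "supp (rep_top m) \<mu> \<subseteq> zero_set m A lam V \<longleftrightarrow> (AE (x, c, a) in \<mu>. slack c a x = 0)"
proof -
  note \<mu>D = holonomicD[OF \<mu>]
  let ?U = "{(x, c, a). c \<in> {..<m} \<and> a \<in> {0, 1} \<and> slack c a x \<noteq> 0}"
  have Z: "zero_set m A lam V = topspace (rep_top m) - ?U"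
    by (auto simp: zero_set_def topspace_rep_top slack_def)
  have sets: "U \<in> sets \<mu>" if "openin (rep_top m) U" for U
    using openin_rep_top_measurable[OF that] \<mu>D(2) by simp
  have AE: "(AE (x, c, a) in \<mu>. slack c a x = 0) \<longleftrightarrow> emeasure \<mu> ?U = 0"
    using sets[OF openin_slack_nonzero]
    by (intro AE_iff_measurable[of ?U]) (auto simp: \<mu>D(3))
  show ?thesis
  proof
    assume "supp (rep_top m) \<mu> \<subseteq> zero_set m A lam V"
    then have "?U \<subseteq> topspace (rep_top m) - supp (rep_top m) \<mu>"
      unfolding Z by (auto simp: topspace_rep_top)
    then have "emeasure \<mu> ?U \<le> emeasure \<mu> (topspace (rep_top m) - supp (rep_top m) \<mu>)"
      by (rule emeasure_mono[OF _ emeasure_compl_supp(2)[OF second_countable_rep_top sets]])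
    also have "\<dots> = 0"
      by (rule emeasure_compl_supp(1)[OF second_countable_rep_top sets])
    finally have "emeasure \<mu> ?U = 0" by simp
    then show "AE (x, c, a) in \<mu>. slack c a x = 0" unfolding AE by simp
  next
    assume "AE (x, c, a) in \<mu>. slack c a x = 0"
    then show "supp (rep_top m) \<mu> \<subseteq> zero_set m A lam V"
      unfolding AE Z supp_def using openin_slack_nonzero by fastforce
  qed
qed

end


section \<open>Maximizing measures and their supports\<close>

theorem theorem3p6:
  fixes lam :: real and m :: nat and A :: "nat \<Rightarrow> circle \<Rightarrow> real" and \<nu> :: "circle measure"
  assumes "0 < lam" and "lam < 1" and "2 \<le> m"
    and "\<And>c. c < m \<Longrightarrow> \<exists>L. L-lipschitz_on UNIV (A c)"
    and "\<nu> \<in> space (prob_algebra borel)"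
  shows "(\<exists>!v. bellman_solution m A lam v) \<and>
    (let v = v_lam m A lam; Z = zero_set m A lam v in
      (\<forall>\<mu> \<in> holonomic m lam \<nu>.
        (maximizing m A lam \<nu> \<mu> \<longleftrightarrow> supp (rep_top m) \<mu> \<subseteq> Z) \<and>
        (supp (circle_top m) \<mu> \<subseteq> Z \<longrightarrow> maximizing m A lam \<nu> \<mu>) \<and>
        (maximizing m A lam \<nu> \<mu> \<longrightarrow> supp (circle_top m) \<mu> - {proj 0} \<times> UNIV \<subseteq> Z)) \<and>
      superior_boundary (Lam m A lam) = {(x, v x) |x. True} \<and>
      (\<forall>\<mu>. maximizing m A lam \<nu> \<mu> \<longrightarrow>
        (AE (x, c, a) in \<mu>. G A lam c (tau a x, v (tau a x)) = (x, v x))))"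
proof -
  interpret discounted_skew_ifs lam m A
  proof
    show "continuous_on UNIV (A c)" if "c < m" for c
      using assms(4)[OF that] lipschitz_on_continuous_on by blast
  qed (use assms in auto)
  have \<nu>: "prob_space \<nu>" "sets \<nu> = sets borel"
    using assms(5) by (auto simp: space_prob_algebra)
  note max_iff = maximizing_iff_AE[OF \<nu>]
  have supp_iff: "maximizing m A lam \<nu> \<mu> \<longleftrightarrow> supp (rep_top m) \<mu> \<subseteq> zero_set m A lam V"
    if "\<mu> \<in> holonomic m lam \<nu>" for \<mu>
    using max_iff[OF that] supp_rep_top_subset_zero_set_iff[OF that] by simp
  have G: "AE (x, c, a) in \<mu>. G A lam c (tau a x, V (tau a x)) = (x, V x)"
    if "maximizing m A lam \<nu> \<mu>" for \<mu>
  proof -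
    have "AE (x, c, a) in \<mu>. slack c a x = 0"
      using that max_iff unfolding maximizing_def by blast
    then show ?thesis
      by (rule AE_mp) (auto simp: G_def doubling_tau slack_def disc_diff_def)
  qed
  have 1: "supp (circle_top m) \<mu> \<subseteq> zero_set m A lam V \<longrightarrow> maximizing m A lam \<nu> \<mu>"
    if "\<mu> \<in> holonomic m lam \<nu>" for \<mu>
    using supp_iff[OF that] supp_rep_top_subset by blast
  have 2: "maximizing m A lam \<nu> \<mu> \<longrightarrow>
      supp (circle_top m) \<mu> - {proj 0} \<times> UNIV \<subseteq> zero_set m A lam V"
    if "\<mu> \<in> holonomic m lam \<nu>" for \<mu>
    using supp_iff[OF that] supp_circle_top_subset[OF holonomicD(2)[OF that]] by blast
  show ?thesis
    unfolding Let_def V_def[symmetric]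
    using ex1_bellman_solution supp_iff 1 2 superior_boundary_eq G by blast
qed

end
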